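(* Assume that $(\mathbb{K}_h,\rho_h)$ is a complete metric space and that there is a function $R\mapsto C_R$ as in the context such that $\rho_h(x^*,(x+th)^* )\le C_R^2\,t$ for all $t>0$, all $R\in[1,\infty]$ and all $x\in\mathbb{K}$ with $h\le x\le Rh$. Let $0<r\le R\le\infty$ with $r<\infty$, and let $\{x_n\}_{n\ge1}$ be a sequence in $\mathbb{K}$ with $rh\le x_n\le Rh$ for all $n\ge1$. If $q$ is a real number such that $$\frac{C_{\upsilon(R,r)/\upsilon(r,R)}}{\upsilon(r,R)}<q<1,$$ then the continued fraction $z_n=[x_1,\dots,x_n]$ converges in $\rho_h$ to some $z\in\mathbb{K}_h$, and there is an integer $k\ge1$ such that for all $n\ge1$ $$\rho_h(z_n,z)\le\frac{q^{2(n-2k)}}{1-q^2}\,r^{-1}.$$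
   Context: $\mathbb{K}$ is a partially ordered abelian semigroup with neutral element $\mathbf{e}$ such that $\mathbf{e}\le x$ for all $x\in\mathbb{K}$ and $x\le y$ implies $x+z\le y+z$ (in particular $y=x+z$ implies $x\le y$). It is equipped with an order reversing involution $x\mapsto x^*$: $x^{**}=x$, and $x\le y$ implies $y^*\le x^*$ (the involution need not commute with addition). Approximants are defined by $[x_1]=x_1^*$ and $[x_1,\dots,x_{n+1}]=(x_1+[x_2,\dots,x_{n+1}])^*$, $n\ge1$. $\mathbb{K}$ has a scaling $x\mapsto ax$ by reals $a>0$ with $1x=x$, $a(bx)=(ab)x$, $a(x+y)=ax+ay$, $(a+b)x=ax+bx$, $x\le y\Rightarrow ax\le ay$, and $(ax)^*=a^{-1}x^*$. A self-polar element $h\in\mathbb{K}$ ($h^*=h$) is fixed; conventions: $0h=\mathbf{e}$, $\infty h=\mathbf{e}^*$. Define $\rho_h(x,y)=\inf\{t\ge0:\ x\le y+th,\ y\le x+th\}$ (with $\inf\emptyset=\infty$) and $\mathbb{K}_h=\{x\in\mathbb{K}: x\le ah\text{ for some }a>0\}$. It is assumed that $\bigcap_{t>0}\{x\in\mathbb{K}: x\le y+th\}=\{x\in\mathbb{K}:x\le y\}$ for all $y\in\mathbb{K}$; then $\rho_h$ is a metric on $\mathbb{K}_h$. $C_R$, $R\in[1,\infty]$, denotes a positive finite function, chosen non-decreasing and right-continuous in $R$. For $r,R\in(0,\infty]$, $\upsilon(r,R)=\tfrac12\big(\sqrt{r^2+4r/R}+r\big)$, which is the reciprocal of the value of the numerical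 periodic continued fraction $[r,R,r,R,\dots]$; for finite $r$, $\upsilon(r,\infty)=r$, $\upsilon(\infty,r)=\infty$, and then $\upsilon(\infty,r)/\upsilon(r,\infty)=\infty$. *)

theory Defs
  imports "HOL-Analysis.Analysis"
begin

text \<open>The neutral element \<open>e\<close> of \<open>K\<close> is \<open>0\<close>, and \<open>star x\<close> stands for \<open>x\<^sup>*\<close>.\<close>

locale polar_semigroup =
  fixes star :: "'a::ordered_comm_monoid_add \<Rightarrow> 'a"
  assumes neutral_le: "0 \<le> x"
    and star_star: "star (star x) = x"
    and star_antimono: "x \<le> y \<Longrightarrow> star y \<le> star x"
begin

text \<open>The approximant \<open>[x\<^sub>1, \<dots>, x\<^sub>n]\<close>; it is left unspecified on the empty list.\<close>

fun approximant :: "'a list \<Rightarrow> 'a" where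
  "approximant [x] = star x"
| "approximant (x # y # ys) = star (x + approximant (y # ys))"

end

text \<open>The values of \<open>scale\<close> at non-positive reals are irrelevant.\<close>

locale scaled_polar_semigroup = polar_semigroup star
  for star :: "'a::ordered_comm_monoid_add \<Rightarrow> 'a" +
  fixes scale :: "real \<Rightarrow> 'a \<Rightarrow> 'a" and h :: 'a
  assumes scale_one: "scale 1 x = x"
    and scale_scale: "0 < a \<Longrightarrow> 0 < b \<Longrightarrow> scale a (scale b x) = scale (a * b) x"
    and scale_add_right: "0 < a \<Longrightarrow> scale a (x + y) = scale a x + scale a y"
    and scale_add_left: "0 < a \<Longrightarrow> 0 < b \<Longrightarrow> scale (a + b) x = scale a x + scale b x"
    and scale_mono: "0 < a \<Longrightarrow> x \<le> y \<Longrightarrow> scale a x \<le> scale a y"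
    and star_scale: "0 < a \<Longrightarrow> star (scale a x) = scale (inverse a) (star x)"
    and self_polar: "star h = h"
    and archimedean: "(\<Inter>t\<in>{0<..}. {x. x \<le> y + scale t h}) = {x. x \<le> y}"
begin

text \<open>\<open>mult_h t\<close> is \<open>t h\<close> for \<open>t \<in> [0, \<infinity>]\<close>, with \<open>0 h = e\<close> and \<open>\<infinity> h = e\<^sup>*\<close>.\<close>

definition mult_h :: "ereal \<Rightarrow> 'a" where
  "mult_h t = (if t = 0 then 0 else if t = \<infinity> then star 0 else scale (real_of_ereal t) h)"

definition rho :: "'a \<Rightarrow> 'a \<Rightarrow> ereal" where
  "rho x y = Inf {ereal t |t. 0 \<le> t \<and> x \<le> y + mult_h (ereal t) \<and> y \<le> x + mult_h (ereal t)}"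

definition K_h :: "'a set" where
  "K_h = {x. \<exists>a>0. x \<le> scale a h}"

text \<open>\<open>rho\<close> is finite on \<open>K_h\<close>, where it is a metric; \<open>rho_real\<close> is this metric as a
  real-valued function.\<close>

definition rho_real :: "'a \<Rightarrow> 'a \<Rightarrow> real" where
  "rho_real x y = real_of_ereal (rho x y)"

lemma mult_h_simps:
  "mult_h 0 = 0" "0 < t \<Longrightarrow> mult_h (ereal t) = scale t h"
  by (auto simp: mult_h_def)

lemma mult_h_add:
  assumes "0 \<le> s" "0 \<le> t"
  shows "mult_h (ereal (s + t)) = mult_h (ereal s) + mult_h (ereal t)"
  using assms by (cases "s = 0"; cases "t = 0")
    (auto simp: mult_h_simps scale_add_left zero_ereal_def[symmetric] simp del: plus_ereal.simps)

lemma mult_h_mono: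
  assumes "0 \<le> s" "s \<le> t"
  shows "mult_h (ereal s) \<le> mult_h (ereal t)"
  using mult_h_add[of s "t - s"] assms neutral_le[of "mult_h (ereal (t - s))"]
    add_left_mono[of 0 "mult_h (ereal (t - s))" "mult_h (ereal s)"] by simp

lemma rho_nonneg: "0 \<le> rho x y"
  unfolding rho_def by (auto intro!: Inf_greatest)

lemma rho_le:
  assumes "0 \<le> t" "x \<le> y + mult_h (ereal t)" "y \<le> x + mult_h (ereal t)"
  shows "rho x y \<le> ereal t"
  unfolding rho_def using assms by (auto intro!: Inf_lower)

lemma rho_lessD:
  assumes "rho x y < ereal t"
  shows "0 < t" "x \<le> y + mult_h (ereal t)" "y \<le> x + mult_h (ereal t)"
proof -
  obtain s where s: "s < t" "0 \<le> s" "x \<le> y + mult_h (ereal s)" "y \<le> x + mult_h (ereal s)"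
    using assms unfolding rho_def Inf_less_iff by auto
  then show "0 < t" by simp
  have "mult_h (ereal s) \<le> mult_h (ereal t)"
    using s by (intro mult_h_mono) auto
  then show "x \<le> y + mult_h (ereal t)" "y \<le> x + mult_h (ereal t)"
    using s by (meson add_left_mono order_trans)+
qed

lemma rho_finite:
  assumes "x \<in> K_h" "y \<in> K_h"
  shows "\<exists>t. rho x y = ereal t"
proof -
  obtain a b where ab: "a > 0" "x \<le> scale a h" "b > 0" "y \<le> scale b h"
    using assms unfolding K_h_def by auto
  have "x \<le> mult_h (ereal (a + b))" "y \<le> mult_h (ereal (a + b))"
    using ab mult_h_mono[of a "a + b"] mult_h_mono[of b "a + b"]
    by (auto simp: mult_h_simps simp del: plus_ereal.simps)
  then have "rho x y \<le> ereal (a + b)"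
    using ab neutral_le by (intro rho_le) (auto intro: add_increasing)
  then show ?thesis
    using rho_nonneg[of x y] by (cases "rho x y") auto
qed

lemma le_if_rho_eq_0:
  assumes "rho x y = 0"
  shows "x \<le> y"
proof -
  have "x \<le> y + scale t h" if "t > 0" for t
    using rho_lessD(2)[of x y t] assms that by (simp add: mult_h_simps)
  then have "x \<in> (\<Inter>t\<in>{0<..}. {x. x \<le> y + scale t h})" by auto
  then show ?thesis unfolding archimedean by simp
qed

lemma rho_commute: "rho x y = rho y x"
  unfolding rho_def by (rule arg_cong[where f = Inf]) auto

lemma rho_real_triangle:
  assumes "x \<in> K_h" "y \<in> K_h" "z \<in> K_h"
  shows "rho_real x z \<le> rho_real x y + rho_real y z"
proof (rule field_le_epsilon)
  fix e :: real assume e: "0 < e"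
  obtain s t u where st: "rho x y = ereal s" "rho y z = ereal t" "rho x z = ereal u"
    using rho_finite assms by metis
  have 1: "0 < s + e/2" "x \<le> y + mult_h (ereal (s + e/2))" "y \<le> x + mult_h (ereal (s + e/2))"
    using rho_lessD[of x y "s + e/2"] st e by (auto simp del: plus_ereal.simps)
  have 2: "0 < t + e/2" "y \<le> z + mult_h (ereal (t + e/2))" "z \<le> y + mult_h (ereal (t + e/2))"
    using rho_lessD[of y z "t + e/2"] st e by (auto simp del: plus_ereal.simps)
  have eq: "mult_h (ereal (s + e/2 + (t + e/2))) = mult_h (ereal (s + e/2)) + mult_h (ereal (t + e/2))"
    using 1 2 by (intro mult_h_add) auto
  have "rho x z \<le> ereal (s + e/2 + (t + e/2))"
  proof (rule rho_le)
    show "x \<le> z + mult_h (ereal (s + e/2 + (t + e/2)))"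
      unfolding eq using order_trans[OF 1(2) add_right_mono[OF 2(2)]] by (simp add: ac_simps)
    show "z \<le> x + mult_h (ereal (s + e/2 + (t + e/2)))"
      unfolding eq using order_trans[OF 2(3) add_right_mono[OF 1(3)]] by (simp add: ac_simps)
  qed (use 1 2 in auto)
  then show "rho_real x z \<le> rho_real x y + rho_real y z + e"
    using st by (simp add: rho_real_def)
qed

lemma metric_space_K_h: "Metric_space K_h rho_real"
proof
  show "0 \<le> rho_real x y" for x y
    unfolding rho_real_def using rho_nonneg by (simp add: real_of_ereal_pos)
  show "rho_real x y = rho_real y x" for x y
    unfolding rho_real_def by (simp add: rho_commute)
  show "rho_real x y = 0 \<longleftrightarrow> x = y" if "x \<in> K_h" "y \<in> K_h" for x y
  proof
    assume "rho_real x y = 0"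
    then have "rho x y = 0"
      using rho_finite[OF that] by (auto simp: rho_real_def zero_ereal_def)
    then show "x = y"
      using le_if_rho_eq_0[of x y] le_if_rho_eq_0[of y x] by (simp add: rho_commute)
  next
    assume "x = y"
    then have "rho x y \<le> ereal 0"
      by (intro rho_le) (auto simp: mult_h_simps zero_ereal_def[symmetric])
    then show "rho_real x y = 0"
      using rho_nonneg[of x y] by (simp add: rho_real_def zero_ereal_def[symmetric])
  qed
qed (rule rho_real_triangle)

end

text \<open>\<open>(sqrt (r\<^sup>2 + 4 r / R) + r) / 2\<close> for \<open>r, R \<in> (0, \<infinity>]\<close>. Since \<open>x / \<infinity> = 0\<close> in
  \<^typ>\<open>ereal\<close>, its value at \<open>(r, \<infinity>)\<close> is \<open>r\<close>.\<close>

definition upsilon :: "ereal \<Rightarrow> ereal \<Rightarrow> ereal" where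
  "upsilon r R = (if r = \<infinity> then \<infinity>
    else ereal ((sqrt ((real_of_ereal r)\<^sup>2 + real_of_ereal (4 * r / R)) + real_of_ereal r) / 2))"

lemma upsilon_simps:
  "0 < r \<Longrightarrow> 0 < R \<Longrightarrow> upsilon (ereal r) (ereal R) = ereal ((sqrt (r\<^sup>2 + 4 * r / R) + r) / 2)"
  "0 < r \<Longrightarrow> upsilon (ereal r) \<infinity> = ereal r"
  "upsilon \<infinity> R = \<infinity>"
  by (auto simp: upsilon_def)

end

theory Submission
  imports Defs
begin

text \<open>
  Write the approximants as iterates of the maps \<open>w \<mapsto> (a + w)\<^sup>*\<close>. Two approximants with the
  common initial segment \<open>us\<close> arise from two tails by applying the same \<open>length us\<close> maps,
  so it is enough to find a contraction factor for these maps.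

  The involution reverses order and inverts scalars, so by \<open>cf_le_recip\<close> every nonempty tail lies
  between \<open>0\<close> and \<open>h / r\<close>; any two of them are at distance at most \<open>1 / r\<close>. If moreover
  \<open>u h \<le> y \<le> u S h\<close>, then rescaling by \<open>1 / u\<close> brings \<open>y\<close> between \<open>h\<close> and \<open>S h\<close>, and the
  hypothesis on the involution gives Lipschitz constant \<open>(C S / u)\<^sup>2\<close> at \<open>y\<close>: one factor
  \<open>1 / u\<close> comes from rescaling the increment, the other from the involution
  (\<open>rho_star_le\<close>).

  It remains to have \<open>C S / u < q\<close>. Sandwiching \<open>a + w\<close> repeatedly between the numerical
  continued fractions with alternating entries \<open>r\<close> and \<open>R\<close> improves the trivial lower bound
  \<open>r h\<close> to \<open>lower_bound r R k h\<close>, once the tail \<open>w\<close> has at least \<open>2 k\<close> entries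
  (\<open>cf_bounds\<close>). For finite \<open>R\<close> these numbers increase to \<open>upsilon r R\<close>, and the corresponding upper bounds decrease
  to \<open>upsilon R r\<close>, so the ratio \<open>S\<close> decreases to \<open>upsilon R r / upsilon r R\<close> and
  right-continuity of \<open>C\<close> yields the inequality for a suitable \<open>k\<close>
  (\<open>exists_contracting_bound\<close>). For \<open>R = \<infinity>\<close> the trivial bound is already optimal, since
  \<open>upsilon r \<infinity> = r\<close>. Only the innermost \<open>2 k\<close> maps may fail to contract, which explains
  the exponent \<open>2 (n - 2 k)\<close>.
\<close>

section \<open>The involution and the distance\<close>

context scaled_polar_semigroup
begin

lemma le_add_self:
  fixes x y :: 'a
  shows "x \<le> x + y" "x \<le> y + x"
  using add_left_mono[OF neutral_le, of x y] add_right_mono[OF neutral_le, of x y] by simp_all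

lemma le_star_zero: "x \<le> star 0"
  using star_antimono[OF neutral_le[of "star x"]] by (simp add: star_star)

lemma scale_le_mult_h:
  assumes "0 < a" "0 < S" "y \<le> mult_h S"
  shows "scale a y \<le> mult_h (ereal a * S)"
proof (cases S)
  case (real s)
  then show ?thesis
    using assms scale_mono[OF assms(1), of y "scale s h"] by (simp add: mult_h_simps scale_scale)
next
  case PInf
  then show ?thesis using assms le_star_zero by (simp add: mult_h_def)
qed (use assms in simp)

text \<open>The infimum in the definition of \<open>rho\<close> is attained, because the order is closed under
  perturbations by small multiples of \<open>h\<close>.\<close>

lemma le_if_rho_le:
  assumes "rho x y \<le> ereal t" "0 \<le> t"
  shows "x \<le> y + mult_h (ereal t)"
proof -
  have "x \<le> (y + mult_h (ereal t)) + scale s h" if "0 < s" for s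
  proof -
    have "rho x y < ereal (t + s)"
      using assms that by (auto intro: le_less_trans)
    moreover have "mult_h (ereal (t + s)) = mult_h (ereal t) + scale s h"
      using assms that mult_h_add[of t s] mult_h_simps(2)[of s] by simp
    ultimately show ?thesis
      using rho_lessD(2)[of x y "t + s"] by (simp add: add.assoc)
  qed
  then have "x \<in> (\<Inter>s\<in>{0<..}. {x. x \<le> (y + mult_h (ereal t)) + scale s h})" by auto
  then show ?thesis unfolding archimedean by simp
qed

lemma rho_add_left_le:
  assumes "rho x y \<le> ereal t" "0 \<le> t"
  shows "rho (a + x) (a + y) \<le> ereal t"
proof (rule rho_le)
  show "a + x \<le> a + y + mult_h (ereal t)"
    using add_left_mono[OF le_if_rho_le[OF assms], of a] by (simp add: add.assoc)
  show "a + y \<le> a + x + mult_h (ereal t)"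
    using add_left_mono[OF le_if_rho_le[of y x t], of a] assms
    by (simp add: add.assoc rho_commute)
qed (fact assms)

text \<open>One half of the Lipschitz estimate. Applying the hypothesis to \<open>y / u\<close> replaces the increment
  \<open>t h\<close> by \<open>(t / u) h\<close>; scaling the result back through the involution costs a
  second factor \<open>1 / u\<close>.\<close>

lemma star_le_star_add:
  assumes lip: "\<And>t y. 0 < t \<Longrightarrow> h \<le> y \<Longrightarrow> y \<le> mult_h S \<Longrightarrow>
                  rho (star y) (star (y + scale t h)) \<le> ereal (c\<^sup>2 * t)"
    and pos: "0 < c" "0 < u" "0 < S" "0 < t"
    and y: "scale u h \<le> y" "y \<le> mult_h (ereal u * S)"
    and le: "y' \<le> y + scale t h"
  shows "star y \<le> star y' + scale ((c / u)\<^sup>2 * t) h"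
proof -
  define v where "v = inverse u"
  have v: "0 < v" "u = inverse v" "v * u = 1" using pos by (auto simp: v_def)
  have lower: "h \<le> scale v y"
    using scale_mono[OF v(1) y(1)] pos v by (simp add: scale_scale scale_one)
  have "ereal v * (ereal u * S) = S"
    using v by (simp add: mult.assoc[symmetric] one_ereal_def[symmetric])
  then have upper: "scale v y \<le> mult_h S"
    using scale_le_mult_h[OF v(1) _ y(2)] pos
    by (simp add: ereal_zero_less_0_iff)
  have sum: "scale v y + scale (v * t) h = scale v (y + scale t h)"
    using v pos by (simp add: scale_add_right scale_scale)
  have "star (scale v y) \<le> star (scale v (y + scale t h)) + scale (c\<^sup>2 * (v * t)) h"
    using le_if_rho_le[OF lip[OF _ lower upper, of "v * t"]] v pos
    by (simp add: sum mult_h_simps)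
  moreover have "scale v (star (scale v w)) = star w" for w
    using v by (simp add: star_scale scale_scale scale_one)
  moreover have "scale v (scale (c\<^sup>2 * (v * t)) h) = scale (v * (c\<^sup>2 * (v * t))) h"
    using v pos by (simp add: scale_scale)
  ultimately have "star y \<le> star (y + scale t h) + scale (v * (c\<^sup>2 * (v * t))) h"
    using scale_mono[OF v(1)] scale_add_right[OF v(1)] by metis
  also have "v * (c\<^sup>2 * (v * t)) = (c / u)\<^sup>2 * t"
    by (simp add: v_def power2_eq_square divide_inverse)
  also have "star (y + scale t h) + scale ((c / u)\<^sup>2 * t) h
               \<le> star y' + scale ((c / u)\<^sup>2 * t) h"
    by (intro add_right_mono star_antimono le)
  finally show ?thesis .
qed

lemma rho_star_le:
  assumes lip: "\<And>t y. 0 < t \<Longrightarrow> h \<le> y \<Longrightarrow> y \<le> mult_h S \<Longrightarrow>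
                  rho (star y) (star (y + scale t h)) \<le> ereal (c\<^sup>2 * t)"
    and pos: "0 < c" "0 < u" "0 < S" "0 < t"
    and y: "scale u h \<le> y" "y \<le> mult_h (ereal u * S)"
    and y': "scale u h \<le> y'" "y' \<le> mult_h (ereal u * S)"
    and rho: "rho y y' \<le> ereal t"
  shows "rho (star y) (star y') \<le> ereal ((c / u)\<^sup>2 * t)"
proof -
  have le: "y \<le> y' + scale t h" "y' \<le> y + scale t h"
    using le_if_rho_le[of y y' t] le_if_rho_le[of y' y t] rho pos
    by (simp_all add: rho_commute mult_h_simps)
  have "0 < (c / u)\<^sup>2 * t" using pos by simp
  then show ?thesis
    using star_le_star_add[OF lip pos y le(2)] star_le_star_add[OF lip pos y' le(1)]
    by (intro rho_le) (simp_all add: mult_h_simps)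
qed


section \<open>Continued fractions as iterated maps\<close>

text \<open>Unlike \<open>approximant\<close>, this is defined at the empty list, with value the neutral element, so that it
  obeys a single recursion.\<close>

definition cf :: "'a list \<Rightarrow> 'a" where
  "cf xs = foldr (\<lambda>a w. star (a + w)) xs 0"

lemma cf_simps: "cf [] = 0" "cf (a # xs) = star (a + cf xs)"
  by (simp_all add: cf_def)

lemma approximant_eq_cf: "xs \<noteq> [] \<Longrightarrow> approximant xs = cf xs"
  by (induction xs rule: approximant.induct) (simp_all add: cf_simps)

lemma cf_le_recip:
  assumes "0 < r" "\<And>a. a \<in> set xs \<Longrightarrow> scale r h \<le> a" "xs \<noteq> []"
  shows "cf xs \<le> scale (inverse r) h"
proof -
  obtain a ys where xs: "xs = a # ys" using assms(3) by (cases xs) auto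
  have "scale r h \<le> a + cf ys"
    using assms(2)[of a] le_add_self(1) xs by (auto intro: order_trans)
  from star_antimono[OF this] show ?thesis
    using assms(1) by (simp add: xs cf_simps star_scale self_polar)
qed

lemma rho_cf_le_recip:
  assumes "0 < r" "\<And>a. a \<in> set xs \<union> set ys \<Longrightarrow> scale r h \<le> a" "xs \<noteq> []" "ys \<noteq> []"
  shows "rho (cf xs) (cf ys) \<le> ereal (inverse r)"
  using assms cf_le_recip[of r xs] cf_le_recip[of r ys] le_add_self(2)
  by (intro rho_le) (auto simp: mult_h_simps intro: order_trans)

lemma rho_cf_append_le:
  assumes lip: "\<And>t y. 0 < t \<Longrightarrow> h \<le> y \<Longrightarrow> y \<le> mult_h S \<Longrightarrow>
                  rho (star y) (star (y + scale t h)) \<le> ereal (c\<^sup>2 * t)"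
    and pos: "0 < c" "0 < u" "0 < S" "0 < t"
    and range: "\<And>a ws. a \<in> A \<Longrightarrow> set ws \<subseteq> A \<Longrightarrow> m \<le> length ws \<Longrightarrow>
                  scale u h \<le> a + cf ws \<and> a + cf ws \<le> mult_h (ereal u * S)"
    and tails: "set ws \<subseteq> A" "set ws' \<subseteq> A" "m \<le> length ws" "m \<le> length ws'"
    and rho: "rho (cf ws) (cf ws') \<le> ereal t"
    and us: "set us \<subseteq> A"
  shows "rho (cf (us @ ws)) (cf (us @ ws')) \<le> ereal ((c / u) ^ (2 * length us) * t)"
  using us
proof (induction us)
  case Nil
  then show ?case using rho by simp
next
  case (Cons a us)
  let ?t = "(c / u) ^ (2 * length us) * t"
  have t: "0 < ?t" using pos by simp
  have "rho (a + cf (us @ ws)) (a + cf (us @ ws')) \<le> ereal ?t"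
    using Cons t by (intro rho_add_left_le) auto
  moreover have "scale u h \<le> a + cf (us @ ws) \<and> a + cf (us @ ws) \<le> mult_h (ereal u * S)"
    using Cons.prems tails by (intro range) auto
  moreover have "scale u h \<le> a + cf (us @ ws') \<and> a + cf (us @ ws') \<le> mult_h (ereal u * S)"
    using Cons.prems tails by (intro range) auto
  ultimately have "rho (cf ((a # us) @ ws)) (cf ((a # us) @ ws')) \<le> ereal ((c / u)\<^sup>2 * ?t)"
    using rho_star_le[OF lip pos(1-3) t] by (simp add: cf_simps)
  then show ?case by (simp add: power2_eq_square mult.assoc)
qed

end


section \<open>Alternating numerical continued fractions\<close>

text \<open>The finite continued fractions \<open>r + 1 / (R + 1 / (r + \<dots>))\<close> of odd length, which
  approach \<open>upsilon r R\<close> from below.\<close>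

fun lower_bound :: "real \<Rightarrow> real \<Rightarrow> nat \<Rightarrow> real" where
  "lower_bound r R 0 = r"
| "lower_bound r R (Suc k) = r + inverse (R + inverse (lower_bound r R k))"

lemma lower_bound_ge:
  assumes "0 < r" "0 < R"
  shows "r \<le> lower_bound r R k"
proof (induction k)
  case (Suc k)
  then have "0 < R + inverse (lower_bound r R k)" using assms by (simp add: add_pos_pos)
  then show ?case by simp
qed simp

text \<open>The defect \<open>u - lower_bound r R k\<close> is multiplied by
  \<open>1 / ((R u + 1) (R l + 1))\<close> in each step, where \<open>l = lower_bound r R k\<close>; so it stays positive and
  decays geometrically.\<close>

lemma lower_bound_defect:
  assumes "0 < r" "0 < R" "0 < u" "u\<^sup>2 = r * u + r / R"
  shows "0 < u - lower_bound r R k \<and> u - lower_bound r R k \<le> (1 / (1 + R * r)) ^ k * (u - r)"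
proof (induction k)
  case 0
  have "0 < u * (u - r)" using assms by (simp add: algebra_simps power2_eq_square)
  then show ?case using assms(3) by (simp add: zero_less_mult_iff)
next
  case (Suc k)
  define l where "l = lower_bound r R k"
  have l: "r \<le> l" "0 < u - l" using lower_bound_ge[OF assms(1,2)] Suc by (auto simp: l_def)
  have R: "1 \<le> 1 + R * u" "0 < 1 + R * l" "0 < 1 + R * r" "1 + R * r \<le> 1 + R * l"
    using assms l by (auto simp: add_pos_pos)
  have fixpoint: "u = r + u / (1 + R * u)"
  proof -
    have "(u - r) * (1 + R * u) = u"
      using assms(2,4) by (simp add: field_simps power2_eq_square)
    then have "u - r = u / (1 + R * u)" using R by (subst eq_divide_eq) auto
    then show ?thesis by simp
  qed
  have "lower_bound r R (Suc k) = r + l / (1 + R * l)"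
    using assms l R by (simp add: l_def[symmetric] field_simps)
  then have "u - lower_bound r R (Suc k) = u / (1 + R * u) - l / (1 + R * l)"
    using fixpoint by simp
  also have "\<dots> = (u - l) / ((1 + R * u) * (1 + R * l))"
    using R by (simp add: field_simps)
  finally have eq: "u - lower_bound r R (Suc k) = (u - l) / ((1 + R * u) * (1 + R * l))" .
  have "1 + R * r \<le> (1 + R * u) * (1 + R * l)"
    using mult_mono[of 1 "1 + R * u" "1 + R * r" "1 + R * l"] R by simp
  then have "(u - l) / ((1 + R * u) * (1 + R * l)) \<le> (u - l) / (1 + R * r)"
    using l R by (intro divide_left_mono) auto
  also have "\<dots> \<le> (1 / (1 + R * r)) ^ k * (u - r) / (1 + R * r)"
    using Suc R by (intro divide_right_mono) (auto simp: l_def)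
  finally show ?case using eq l R by simp
qed

lemma lower_bound_tendsto:
  assumes "0 < r" "0 < R" "0 < u" "u\<^sup>2 = r * u + r / R"
  shows "lower_bound r R \<longlonglongrightarrow> u"
proof -
  have "(\<lambda>k. (1 / (1 + R * r)) ^ k * (u - r)) \<longlonglongrightarrow> 0"
    using assms by (intro tendsto_mult_left_zero LIMSEQ_power_zero) (auto simp: add_pos_pos)
  then have "(\<lambda>k. u - lower_bound r R k) \<longlonglongrightarrow> 0"
    using lower_bound_defect[OF assms]
    by (elim tendsto_sandwich[OF _ _ tendsto_const, rotated 2])
      (auto intro!: always_eventually less_imp_le)
  from tendsto_diff[OF tendsto_const[of u] this] show ?thesis by simp
qed

text \<open>The square root in \<open>upsilon R r\<close> is \<open>R / r\<close> times the one in \<open>upsilon r R\<close>, so interchanging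
  the arguments multiplies the value by \<open>R / r\<close>.\<close>

lemma upsilon_finite:
  assumes "0 < r" "0 < R"
  obtains u where "0 < u" "u\<^sup>2 = r * u + r / R" "upsilon (ereal r) (ereal R) = ereal u"
    "upsilon (ereal R) (ereal r) / upsilon (ereal r) (ereal R) = ereal (R / r)"
proof
  define s where "s = sqrt (r\<^sup>2 + 4 * r / R)"
  define u where "u = (s + r) / 2"
  have s: "s\<^sup>2 = r\<^sup>2 + 4 * r / R" "0 \<le> s" using assms by (simp_all add: s_def)
  show u: "0 < u" using s assms by (simp add: u_def)
  show "u\<^sup>2 = r * u + r / R"
    using s by (simp add: u_def power2_eq_square field_simps)
  show ur: "upsilon (ereal r) (ereal R) = ereal u"
    using assms by (simp add: upsilon_simps u_def s_def)
  have "R\<^sup>2 + 4 * R / r = (R / r * s)\<^sup>2"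
    unfolding power_mult_distrib s using assms by (simp add: field_simps power2_eq_square)
  then have "sqrt (R\<^sup>2 + 4 * R / r) = R / r * s"
    using s assms by (simp add: real_sqrt_abs)
  then have "upsilon (ereal R) (ereal r) = ereal (R / r * u)"
    using assms by (simp add: upsilon_simps u_def field_simps)
  then show "upsilon (ereal R) (ereal r) / upsilon (ereal r) (ereal R) = ereal (R / r)"
    using ur u by simp
qed

context scaled_polar_semigroup
begin

text \<open>Each application of the involution turns a lower bound of the tail starting one entry later
  into an upper bound of the current one and vice versa; a new lower bound therefore costs two
  entries.\<close>

lemma cf_bounds:
  assumes "0 < r" "0 < R" "set xs \<subseteq> {scale r h..scale R h}"
  shows "2 * k \<le> length xs \<Longrightarrow> scale r h \<le> a \<Longrightarrow> scale (lower_bound r R k) h \<le> a + cf xs"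
    and "2 * k < length xs \<Longrightarrow> cf xs \<le> scale (inverse (lower_bound r R k)) h"
proof -
  have pos: "0 < lower_bound r R k" for k using lower_bound_ge[OF assms(1,2), of k] assms(1) by simp
  have upper: "cf xs \<le> scale (inverse (lower_bound r R k)) h"
    if len: "2 * k < length xs" and xs_range: "set xs \<subseteq> {scale r h..scale R h}"
      and lower: "\<And>ys a. set ys \<subseteq> {scale r h..scale R h} \<Longrightarrow> 2 * k \<le> length ys \<Longrightarrow>
              scale r h \<le> a \<Longrightarrow> scale (lower_bound r R k) h \<le> a + cf ys" for xs k
  proof -
    obtain b ys where xs: "xs = b # ys" using len by (cases xs) auto
    have "scale (lower_bound r R k) h \<le> b + cf ys"
      using len xs_range by (intro lower) (auto simp: xs)
    from star_antimono[OF this] show ?thesis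
      using pos by (simp add: xs cf_simps star_scale self_polar)
  qed
  have lower: "scale (lower_bound r R k) h \<le> a + cf xs"
    if "set xs \<subseteq> {scale r h..scale R h}" "2 * k \<le> length xs" "scale r h \<le> a" for xs k a
    using that
  proof (induction k arbitrary: xs a)
    case 0
    then show ?case using le_add_self(1) by (auto intro: order_trans)
  next
    case (Suc k)
    let ?U = "R + inverse (lower_bound r R k)"
    have U: "0 < ?U" using assms pos[of k] by (simp add: add_pos_pos)
    obtain b ys where xs: "xs = b # ys" using Suc.prems(2) by (cases xs) auto
    have "cf ys \<le> scale (inverse (lower_bound r R k)) h"
      using Suc by (intro upper) (auto simp: xs)
    then have "b + cf ys \<le> scale R h + scale (inverse (lower_bound r R k)) h"
      using Suc.prems(1) by (intro add_mono) (auto simp: xs)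
    then have "b + cf ys \<le> scale ?U h"
      using assms pos[of k] by (simp add: scale_add_left)
    from star_antimono[OF this] have "scale (inverse ?U) h \<le> cf xs"
      using U by (simp add: xs cf_simps star_scale self_polar)
    with Suc.prems(3) have "scale r h + scale (inverse ?U) h \<le> a + cf xs"
      by (rule add_mono)
    then show ?case using assms U by (simp add: scale_add_left)
  qed
  show "scale (lower_bound r R k) h \<le> a + cf xs" if "2 * k \<le> length xs" "scale r h \<le> a"
    using lower assms(3) that by blast
  show "cf xs \<le> scale (inverse (lower_bound r R k)) h" if "2 * k < length xs"
    using upper lower assms(3) that by blast
qed


section \<open>Contraction and convergence\<close>

lemma exists_contracting_bound:
  fixes C :: "ereal \<Rightarrow> real"
  assumes C_right_cont: "\<And>S. 1 \<le> S \<Longrightarrow> continuous (at_right S) C"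
    and r_R: "0 < r" "ereal r \<le> R"
    and q: "ereal (C (upsilon R (ereal r) / upsilon (ereal r) R)) / upsilon (ereal r) R < ereal q"
  obtains k u S where "1 \<le> k" "0 < u" "1 \<le> S" "C S / u < q"
    "\<And>a ws. a \<in> {scale r h..mult_h R} \<Longrightarrow> set ws \<subseteq> {scale r h..mult_h R} \<Longrightarrow>
       2 * k \<le> length ws \<Longrightarrow> scale u h \<le> a + cf ws \<and> a + cf ws \<le> mult_h (ereal u * S)"
proof (cases R)
  case PInf
  show thesis
  proof (rule that[of 1 r \<infinity>])
    show "C \<infinity> / r < q" using q r_R PInf by (simp add: upsilon_simps)
    show "scale r h \<le> a + cf ws \<and> a + cf ws \<le> mult_h (ereal r * \<infinity>)"
      if "a \<in> {scale r h..mult_h R}" for a ws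
      using that r_R le_star_zero le_add_self(1) by (auto simp: mult_h_def intro: order_trans)
  qed (use r_R in auto)
next
  case (real R')
  have R': "0 < R'" "r \<le> R'" using r_R real by auto
  obtain u where u: "0 < u" "u\<^sup>2 = r * u + r / R'" "upsilon (ereal r) (ereal R') = ereal u"
    "upsilon (ereal R') (ereal r) / upsilon (ereal r) (ereal R') = ereal (R' / r)"
    using upsilon_finite[OF r_R(1) R'(1)] .
  define L where "L = lower_bound r R'"
  define S where "S k = (R' + inverse (L k)) / L (Suc k)" for k
  have L_pos: "0 < L k" and L_less: "L k < u" for k
    using lower_bound_ge[OF r_R(1) R'(1), of k] lower_bound_defect[OF r_R(1) R'(1) u(1,2), of k] r_R
    by (auto simp: L_def)
  have L_lim: "L \<longlonglongrightarrow> u"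
    unfolding L_def by (rule lower_bound_tendsto[OF r_R(1) R'(1) u(1,2)])
  \<comment> \<open>The identity \<open>R + 1 / u = R u / r\<close> is the quadratic equation for \<open>u\<close>.\<close>
  have ratio: "(R' + inverse u) / u = R' / r"
    using u(1,2) r_R R' by (simp add: field_simps power2_eq_square)
  have S_lim: "S \<longlonglongrightarrow> R' / r"
    unfolding S_def ratio[symmetric]
    using u(1) by (intro tendsto_intros L_lim LIMSEQ_Suc) auto
  \<comment> \<open>Strict, so that the ratios approach their limit inside the one-sided neighbourhood filter.\<close>
  have S_gt: "R' / r < S k" for k
  proof -
    have "inverse u < inverse (L k)" using L_less L_pos u by (intro less_imp_inverse_less) auto
    then show ?thesis
      unfolding S_def ratio[symmetric]
      using L_less[of "Suc k"] L_pos[of "Suc k"] R' u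
      by (intro frac_less2) (auto simp: add_pos_pos)
  qed
  have S_ge: "1 \<le> R' / r" using r_R R' by simp
  have "filterlim (\<lambda>k. ereal (S k)) (at_right (ereal (R' / r))) sequentially"
    unfolding filterlim_at using S_lim S_gt less_imp_neq[OF S_gt]
    by (auto intro!: always_eventually simp: eq_commute)
  moreover have "(C \<longlongrightarrow> C (ereal (R' / r))) (at_right (ereal (R' / r)))"
    using C_right_cont[of "ereal (R' / r)"] S_ge
    by (simp add: continuous_within one_ereal_def)
  ultimately have "(\<lambda>k. C (ereal (S k))) \<longlonglongrightarrow> C (ereal (R' / r))"
    by (rule filterlim_compose[rotated])
  then have "(\<lambda>k. C (ereal (S k)) / L (Suc k)) \<longlonglongrightarrow> C (ereal (R' / r)) / u"
    using u(1) by (intro tendsto_intros LIMSEQ_Suc L_lim) auto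
  moreover have "C (ereal (R' / r)) / u < q"
    using q u unfolding real u(4) by simp
  ultimately have "\<forall>\<^sub>F k in sequentially. C (ereal (S k)) / L (Suc k) < q"
    by (rule order_tendstoD)
  then obtain k where k: "C (ereal (S k)) / L (Suc k) < q"
    by (auto simp: eventually_sequentially)
  show thesis
  proof (rule that[of "Suc k" "L (Suc k)" "ereal (S k)"])
    show "1 \<le> ereal (S k)" using S_gt[of k] S_ge by (simp add: one_ereal_def)
    fix a ws
    assume a: "a \<in> {scale r h..mult_h R}" and ws: "set ws \<subseteq> {scale r h..mult_h R}"
      and len: "2 * Suc k \<le> length ws"
    have mult_R: "mult_h R = scale R' h" using real R' by (simp add: mult_h_simps)
    have "cf ws \<le> scale (inverse (L k)) h"
      unfolding L_def using ws len r_R R' by (intro cf_bounds(2)) (auto simp: mult_R)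
    then have "a + cf ws \<le> scale R' h + scale (inverse (L k)) h"
      using a by (intro add_mono) (auto simp: mult_R)
    also have "\<dots> = scale (L (Suc k) * S k) h"
      using L_pos[of k] L_pos[of "Suc k"] R' by (simp add: S_def scale_add_left)
    also have "\<dots> = mult_h (ereal (L (Suc k)) * ereal (S k))"
      using L_pos[of "Suc k"] S_gt[of k] S_ge by (simp add: mult_h_simps)
    finally show "scale (L (Suc k)) h \<le> a + cf ws \<and>
        a + cf ws \<le> mult_h (ereal (L (Suc k)) * ereal (S k))"
      using cf_bounds(1)[OF r_R(1) R'(1), of ws "Suc k" a] a ws len
      by (simp add: mult_R L_def)
  qed (use k L_pos in auto)
qed (use r_R in auto)

lemma K_h_limit_rho_le:
  assumes complete: "Metric_space.mcomplete K_h rho_real"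
    and z: "\<And>n. z n \<in> K_h"
    and bound: "\<And>m n. 1 \<le> n \<Longrightarrow> n \<le> m \<Longrightarrow> rho (z n) (z m) \<le> ereal (b n)"
    and b: "b \<longlonglongrightarrow> 0"
  obtains l where "l \<in> K_h" "limitin (Metric_space.mtopology K_h rho_real) z l sequentially"
    "\<And>n. 1 \<le> n \<Longrightarrow> rho (z n) l \<le> ereal (b n)"
proof -
  interpret M: Metric_space K_h rho_real by (rule metric_space_K_h)
  have rho_ereal: "rho v w = ereal (rho_real v w)" if "v \<in> K_h" "w \<in> K_h" for v w
    using rho_finite[OF that] by (auto simp: rho_real_def)
  have bound': "rho_real (z n) (z m) \<le> b n" if "1 \<le> n" "n \<le> m" for m n
    using bound[OF that] z by (simp add: rho_ereal)
  have "M.MCauchy z"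
    unfolding M.MCauchy_def
  proof (intro conjI allI impI)
    fix e :: real assume "0 < e"
    with b have "\<forall>\<^sub>F n in sequentially. b n < e" by (rule order_tendstoD)
    then obtain N where N: "\<And>n. N \<le> n \<Longrightarrow> b n < e" by (auto simp: eventually_sequentially)
    have le: "rho_real (z n) (z m) < e" if "Suc N \<le> n" "n \<le> m" for n m
      using bound'[of n m] N[of n] that by simp
    have "rho_real (z n) (z m) < e" if "Suc N \<le> n" "Suc N \<le> m" for n m
      using le[of n m] le[of m n] that by (cases "n \<le> m") (auto simp: M.commute)
    then show "\<exists>N. \<forall>n n'. N \<le> n \<longrightarrow> N \<le> n' \<longrightarrow> rho_real (z n) (z n') < e" by blast
  qed (use z in auto)
  then obtain l where l: "limitin M.mtopology z l sequentially"
    using complete unfolding M.mcomplete_def by blast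
  then have l_K: "l \<in> K_h" and lim: "(\<lambda>n. rho_real (z n) l) \<longlonglongrightarrow> 0"
    by (auto simp: M.limitin_metric_dist_null)
  show thesis
  proof
    fix n :: nat assume n: "1 \<le> n"
    have "rho_real (z n) l \<le> b n + rho_real (z m) l" if "n \<le> m" for m
      using M.triangle[of "z n" "z m" l] bound'[OF n that] z l_K by simp
    then have "rho_real (z n) l \<le> b n + 0"
      by (intro tendsto_lowerbound[OF tendsto_add[OF tendsto_const lim]])
        (auto simp: eventually_sequentially)
    then show "rho (z n) l \<le> ereal (b n)" using z l_K by (simp add: rho_ereal)
  qed (fact l_K l)+
qed

end


section \<open>The convergence theorem\<close>

text \<open>The difference \<open>n - 2 * k\<close> below is truncated: for \<open>n < 2 k\<close> there is no
  contraction, only the bound \<open>1 / r\<close>. Comparing arbitrary \<open>m \<ge> n\<close> at once, rather than consecutive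
  approximants, lets the estimate pass directly to the limit \<open>m \<rightarrow> \<infinity>\<close>.\<close>

lemma (in scaled_polar_semigroup) rho_cf_map_upt_le:
  assumes lip: "\<And>t y. 0 < t \<Longrightarrow> h \<le> y \<Longrightarrow> y \<le> mult_h S \<Longrightarrow>
                  rho (star y) (star (y + scale t h)) \<le> ereal (c\<^sup>2 * t)"
    and pos: "0 < c" "0 < u" "0 < S" "0 < r" and k: "1 \<le> k"
    and range: "\<And>a ws. a \<in> A \<Longrightarrow> set ws \<subseteq> A \<Longrightarrow> 2 * k \<le> length ws \<Longrightarrow>
                  scale u h \<le> a + cf ws \<and> a + cf ws \<le> mult_h (ereal u * S)"
    and A: "\<And>a. a \<in> A \<Longrightarrow> scale r h \<le> a" and x: "\<And>n. 1 \<le> n \<Longrightarrow> x n \<in> A"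
    and n: "1 \<le> n" "n \<le> m"
  shows "rho (cf (map x [1..<Suc n])) (cf (map x [1..<Suc m]))
           \<le> ereal ((c / u) ^ (2 * (n - 2 * k)) * inverse r)"
proof (cases "2 * k \<le> n")
  case True
  let ?i = "Suc (n - 2 * k)"
  let ?us = "map x [1..<?i]"
  let ?ws = "\<lambda>n. map x [?i..<Suc n]"
  have split: "map x [1..<Suc j] = ?us @ ?ws j" if "n \<le> j" for j
    using upt_add_eq_append[of 1 ?i "Suc j - ?i"] that True by simp
  have "rho (cf (?ws n)) (cf (?ws m)) \<le> ereal (inverse r)"
    using True n k x A pos by (intro rho_cf_le_recip) auto
  then have "rho (cf (?us @ ?ws n)) (cf (?us @ ?ws m))
               \<le> ereal ((c / u) ^ (2 * length ?us) * inverse r)"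
    using True n x pos by (intro rho_cf_append_le[OF lip pos(1-3) _ range]) auto
  then show ?thesis using n by (simp only: split length_map length_upt) simp
next
  case False
  have "rho (cf (map x [1..<Suc n])) (cf (map x [1..<Suc m])) \<le> ereal (inverse r)"
    using n x A pos by (intro rho_cf_le_recip) auto
  then show ?thesis using False by simp
qed

theorem theorem3p6:
  fixes star :: "'a::ordered_comm_monoid_add \<Rightarrow> 'a"
    and scale :: "real \<Rightarrow> 'a \<Rightarrow> 'a"
    and h :: 'a
    and C :: "ereal \<Rightarrow> real"
    and r :: real and R :: ereal and q :: real
    and x :: "nat \<Rightarrow> 'a"
  assumes K: "scaled_polar_semigroup star scale h"
    and complete: "Metric_space.mcomplete (scaled_polar_semigroup.K_h scale h)
                     (scaled_polar_semigroup.rho_real star scale h)"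
    and C_pos: "\<And>S. 1 \<le> S \<Longrightarrow> 0 < C S"
    and C_mono: "mono_on {1..} C"
    and C_right_cont: "\<And>S. 1 \<le> S \<Longrightarrow> continuous (at_right S) C"
    and C_bound: "\<And>t S y. 0 < t \<Longrightarrow> 1 \<le> S \<Longrightarrow> h \<le> y \<Longrightarrow>
                    y \<le> scaled_polar_semigroup.mult_h star scale h S \<Longrightarrow>
                    scaled_polar_semigroup.rho star scale h (star y) (star (y + scale t h))
                      \<le> ereal ((C S)\<^sup>2 * t)"
    and r_R: "0 < r" "ereal r \<le> R"
    and x_bounds: "\<And>n. 1 \<le> n \<Longrightarrow> scale r h \<le> x n \<and>
                     x n \<le> scaled_polar_semigroup.mult_h star scale h R"
    and q: "ereal (C (upsilon R (ereal r) / upsilon (ereal r) R)) / upsilon (ereal r) R < ereal q"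
           "q < 1"
  shows "\<exists>z \<in> scaled_polar_semigroup.K_h scale h.
           limitin (Metric_space.mtopology (scaled_polar_semigroup.K_h scale h)
                      (scaled_polar_semigroup.rho_real star scale h))
             (\<lambda>n. polar_semigroup.approximant star (map x [1..<Suc n])) z sequentially \<and>
           (\<exists>k::nat. 1 \<le> k \<and>
             (\<forall>n\<ge>1. scaled_polar_semigroup.rho star scale h
                       (polar_semigroup.approximant star (map x [1..<Suc n])) z
                     \<le> ereal (q powi (2 * (int n - 2 * int k)) / (1 - q\<^sup>2) * inverse r)))"
proof -
  interpret scaled_polar_semigroup star scale h by (fact K)
  obtain k u S where k: "1 \<le> k" and u: "0 < u" and S: "1 \<le> S" and less: "C S / u < q"
    and range: "\<And>a ws. a \<in> {scale r h..mult_h R} \<Longrightarrow> set ws \<subseteq> {scale r h..mult_h R} \<Longrightarrow>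
       2 * k \<le> length ws \<Longrightarrow> scale u h \<le> a + cf ws \<and> a + cf ws \<le> mult_h (ereal u * S)"
    using exists_contracting_bound[OF C_right_cont r_R q(1)] by metis
  define z where "z n = cf (map x [1..<Suc n])" for n
  define b where "b n = q ^ (2 * (n - 2 * k)) * inverse r" for n
  have S_pos: "0 < S" using S by (rule less_le_trans[rotated]) simp
  have C_u: "0 < C S / u" using C_pos[OF S] u by simp
  with less have q0: "0 < q" by simp
  have rho_z: "rho (z n) (z m) \<le> ereal (b n)" if n: "1 \<le> n" "n \<le> m" for m n
  proof -
    have "rho (z n) (z m) \<le> ereal ((C S / u) ^ (2 * (n - 2 * k)) * inverse r)"
      unfolding z_def
      using x_bounds n
      by (intro rho_cf_map_upt_le[OF C_bound[OF _ S] C_pos[OF S] u S_pos r_R(1) k range]) auto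
    also have "\<dots> \<le> ereal (b n)"
      unfolding b_def using C_u less r_R by (auto intro!: mult_right_mono power_mono)
    finally show ?thesis .
  qed
  have z_K: "z n \<in> K_h" for n
  proof (cases "n = 0")
    case True
    then show ?thesis
      using neutral_le[of "scale 1 h"] by (auto simp: z_def cf_simps K_h_def intro!: exI[of _ 1])
  next
    case False
    then have "z n \<le> scale (inverse r) h"
      unfolding z_def using x_bounds r_R(1) by (intro cf_le_recip) auto
    then show ?thesis using r_R(1) by (auto simp: K_h_def intro!: exI[of _ "inverse r"])
  qed
  have "q\<^sup>2 < 1" using q0 q(2) by (simp add: power_less_one_iff)
  then have "(\<lambda>n. (q\<^sup>2) ^ n) \<longlonglongrightarrow> 0" by (intro LIMSEQ_power_zero) simp
  then have "(\<lambda>n. (q\<^sup>2) ^ (n + 2 * k - 2 * k)) \<longlonglongrightarrow> 0" by simp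
  then have "(\<lambda>n. (q\<^sup>2) ^ (n - 2 * k)) \<longlonglongrightarrow> 0"
    by (rule LIMSEQ_offset)
  then have "(\<lambda>n. (q\<^sup>2) ^ (n - 2 * k) * inverse r) \<longlonglongrightarrow> 0"
    by (rule tendsto_mult_left_zero)
  then have "b \<longlonglongrightarrow> 0" by (simp add: b_def[abs_def] power_mult)
  then obtain l where l: "l \<in> K_h" "limitin (Metric_space.mtopology K_h rho_real) z l sequentially"
    and rho_l: "\<And>n. 1 \<le> n \<Longrightarrow> rho (z n) l \<le> ereal (b n)"
    using K_h_limit_rho_le[of z b, OF complete z_K rho_z] by blast
  have approximant_z: "approximant (map x [1..<Suc n]) = z n" if "1 \<le> n" for n
    unfolding z_def using that by (intro approximant_eq_cf) simp
  have b_le: "b n \<le> q powi (2 * (int n - 2 * int k)) / (1 - q\<^sup>2) * inverse r" for n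
  proof -
    have "q ^ (2 * (n - 2 * k)) = q powi int (2 * (n - 2 * k))" by (simp only: power_int_of_nat)
    also have "\<dots> \<le> q powi (2 * (int n - 2 * int k))"
      using q0 q(2) by (intro power_int_decreasing) auto
    also have "\<dots> \<le> q powi (2 * (int n - 2 * int k)) / (1 - q\<^sup>2)"
      using q0 q(2) by (simp add: pos_le_divide_eq power_less_one_iff mult_left_le)
    finally show ?thesis unfolding b_def using r_R(1) by (intro mult_right_mono) auto
  qed
  show ?thesis
  proof (intro bexI[OF _ l(1)] conjI exI[of _ k] allI impI k)
    show "limitin (Metric_space.mtopology K_h rho_real)
        (\<lambda>n. approximant (map x [1..<Suc n])) l sequentially"
      by (rule limitin_transform_eventually[OF _ l(2)],
          rule eventually_mono[OF eventually_ge_at_top[of 1]]) (rule approximant_z[symmetric])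
    show "rho (approximant (map x [1..<Suc n])) l
        \<le> ereal (q powi (2 * (int n - 2 * int k)) / (1 - q\<^sup>2) * inverse r)" if "1 \<le> n" for n
      unfolding approximant_z[OF that] using rho_l[OF that] b_le[of n] by (auto intro: order_trans)
  qed
qed

end
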